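(* Let $\delta>0$. There does not exist a $\delta$-hyperbolic metric space $\mathbb{M}$ which is universal and homogeneous for finite $\delta$-hyperbolic spaces, i.e. such that (universal) every finite $\delta$-hyperbolic metric space embeds isometrically into $\mathbb{M}$, and (homogeneous) every isometry between finite subspaces of $\mathbb{M}$ extends to an isometry of $\mathbb{M}$ onto itself.
   Context: A metric space $(X,d)$ is $\delta$-hyperbolic ($\delta\ge 0$) if for all $x_1,x_2,x_3,x_4\in X$, with $E=d(x_1,x_2)+d(x_3,x_4)$, $F=d(x_1,x_3)+d(x_2,x_4)$, $G=d(x_1,x_4)+d(x_2,x_3)$, one has $G\le\max\{E,F\}+2\delta$. *)

theory Defs
  imports "HOL-Analysis.Abstract_Metric_Spaces"
begin

definition hyperbolic :: "real \<Rightarrow> 'a metric \<Rightarrow> bool" where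
  "hyperbolic \<delta> m \<longleftrightarrow>
     (\<forall>x1\<in>mspace m. \<forall>x2\<in>mspace m. \<forall>x3\<in>mspace m. \<forall>x4\<in>mspace m.
        let E = mdist m x1 x2 + mdist m x3 x4;
            F = mdist m x1 x3 + mdist m x2 x4;
            G = mdist m x1 x4 + mdist m x2 x3
        in G \<le> max E F + 2 * \<delta>)"

definition isometric_embedding :: "'a metric \<Rightarrow> 'b metric \<Rightarrow> ('a \<Rightarrow> 'b) \<Rightarrow> bool" where
  "isometric_embedding m m' f \<longleftrightarrow>
     f \<in> mspace m \<rightarrow> mspace m' \<and>
     (\<forall>x\<in>mspace m. \<forall>y\<in>mspace m. mdist m' (f x) (f y) = mdist m x y)"

definition isometry :: "'a metric \<Rightarrow> 'b metric \<Rightarrow> ('a \<Rightarrow> 'b) \<Rightarrow> bool" where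
  "isometry m m' f \<longleftrightarrow> isometric_embedding m m' f \<and> f ` mspace m = mspace m'"

text \<open>HOL cannot quantify over all types inside a formula, so the finite spaces are taken with
  points in \<^typ>\<open>nat\<close>. This loses nothing: see \<open>universal_embeds_finite\<close> below.\<close>

definition universal_for_finite_hyperbolic :: "real \<Rightarrow> 'a metric \<Rightarrow> bool" where
  "universal_for_finite_hyperbolic \<delta> m \<longleftrightarrow>
     (\<forall>s :: nat metric. finite (mspace s) \<and> hyperbolic \<delta> s \<longrightarrow> (\<exists>f. isometric_embedding s m f))"

definition homogeneous_for_finite :: "'a metric \<Rightarrow> bool" where
  "homogeneous_for_finite m \<longleftrightarrow>
     (\<forall>A B f. finite A \<and> A \<subseteq> mspace m \<and> finite B \<and> B \<subseteq> mspace m \<and>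
        isometry (submetric m A) (submetric m B) f \<longrightarrow>
        (\<exists>g. isometry m m g \<and> (\<forall>x\<in>A. g x = f x)))"

lemma universal_embeds_finite:
  fixes m :: "'a metric" and s :: "'b metric"
  assumes univ: "universal_for_finite_hyperbolic \<delta> m"
    and fin: "finite (mspace s)" and hyp: "hyperbolic \<delta> s"
  shows "\<exists>f. isometric_embedding s m f"
proof -
  obtain h :: "'b \<Rightarrow> nat" where h: "inj_on h (mspace s)"
    using finite_imp_inj_to_nat_seg[OF fin] by blast
  define k where "k = inv_into (mspace s) h"
  define N where "N = h ` mspace s"
  have kh: "k (h x) = x" if "x \<in> mspace s" for x
    using h that by (simp add: k_def)
  have k: "k n \<in> mspace s" if "n \<in> N" for n
    using that kh by (auto simp: N_def)
  have kinj: "k a = k b \<longleftrightarrow> a = b" if "a \<in> N" "b \<in> N" for a b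
    using that kh by (auto simp: N_def)
  interpret S: Metric_space "mspace s" "mdist s" by simp
  interpret N: Metric_space N "\<lambda>a b. mdist s (k a) (k b)"
    by unfold_locales (auto simp: S.commute k kinj intro: S.triangle)
  define t where "t = metric (N, \<lambda>a b. mdist s (k a) (k b))"
  have t: "mspace t = N" "mdist t = (\<lambda>a b. mdist s (k a) (k b))"
    by (simp_all add: t_def)
  have "hyperbolic \<delta> t"
    using hyp k unfolding hyperbolic_def t by blast
  moreover have "finite (mspace t)"
    using fin by (simp add: t N_def)
  ultimately obtain f where "isometric_embedding t m f"
    using univ unfolding universal_for_finite_hyperbolic_def by blast
  then have "isometric_embedding s m (f \<circ> h)"
    unfolding isometric_embedding_def t by (auto simp: N_def kh Pi_iff)
  then show ?thesis by blast
qed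

end

theory Submission
  imports Defs
begin

text \<open>Universality and homogeneity together give amalgamation: two finite hyperbolic spaces
  can be embedded compatibly along their common part. This fails for hyperbolic spaces. Take four
  points \<open>a, b, c, e\<close> with two one-point extensions \<open>x\<close> and \<open>y\<close>. The four-point condition on
  \<open>x, y, a, b\<close> bounds \<open>d(x,y)\<close> from above, and the condition on \<open>x, y, c, e\<close> bounds it from below;
  the distances are chosen such that the lower bound exceeds the upper one. Adding a large constant
  to all distances does not affect the four-point conditions and makes the triangle inequality
  automatic.\<close>

text \<open>Preserving distances makes \<open>f\<close> injective on \<open>A\<close>, so
  \<open>g\<close> after the inverse of \<open>f\<close> is well defined there. This is the partial
  isometry that homogeneity will extend.\<close>

lemma isometry_between_images:
  assumes f: "isometric_embedding s m f" and g: "isometric_embedding t m g"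
    and A: "A \<subseteq> mspace s" "A \<subseteq> mspace t"
    and eq: "\<And>x y. x \<in> A \<Longrightarrow> y \<in> A \<Longrightarrow> mdist s x y = mdist t x y"
  shows "\<exists>h. isometry (submetric m (f ` A)) (submetric m (g ` A)) h \<and> (\<forall>x\<in>A. h (f x) = g x)"
proof -
  interpret S: Metric_space "mspace s" "mdist s" by simp
  define h where "h = g \<circ> inv_into A f"
  have fm: "f x \<in> mspace m" "g x \<in> mspace m" if "x \<in> A" for x
    using that f g A unfolding isometric_embedding_def by (auto simp: Pi_iff)
  have fd: "mdist m (f x) (f y) = mdist s x y" "mdist m (g x) (g y) = mdist s x y"
    if "x \<in> A" "y \<in> A" for x y
    using that f g A eq[OF that] unfolding isometric_embedding_def by (simp_all add: subset_iff)
  have "inj_on f A"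
  proof (rule inj_onI)
    fix x y assume xy: "x \<in> A" "y \<in> A" "f x = f y"
    then have "mdist s x y = mdist s x x"
      using fd(1)[of x y] fd(1)[of x x] by simp
    then show "x = y"
      using xy A S.zero[of x y] by (auto simp: subset_iff)
  qed
  then have h: "h (f x) = g x" if "x \<in> A" for x
    using that by (simp add: h_def)
  have sub: "mspace (submetric m (f ` A)) = f ` A" "mspace (submetric m (g ` A)) = g ` A"
    using fm by auto
  have "isometry (submetric m (f ` A)) (submetric m (g ` A)) h"
    unfolding isometry_def isometric_embedding_def sub
    by (auto simp: h fd image_image cong: image_cong)
  with h show ?thesis by blast
qed

text \<open>Universality embeds both spaces independently, giving two isometric copies of the common
  part. Homogeneity extends the isometry between these copies to some \<open>k\<close> on all of
  \<open>m\<close>, and moving the first embedding by \<open>k\<close> makes the two agree.\<close>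

lemma amalgamation:
  fixes s t :: "nat metric" and m :: "'a metric"
  assumes univ: "universal_for_finite_hyperbolic \<delta> m" and homog: "homogeneous_for_finite m"
    and s: "finite (mspace s)" "hyperbolic \<delta> s" and t: "finite (mspace t)" "hyperbolic \<delta> t"
    and eq: "\<And>x y. x \<in> mspace s \<inter> mspace t \<Longrightarrow> y \<in> mspace s \<inter> mspace t \<Longrightarrow>
      mdist s x y = mdist t x y"
  shows "\<exists>f g. isometric_embedding s m f \<and> isometric_embedding t m g \<and>
    (\<forall>x\<in>mspace s \<inter> mspace t. f x = g x)"
proof -
  let ?A = "mspace s \<inter> mspace t"
  obtain f g where f: "isometric_embedding s m f" and g: "isometric_embedding t m g"
    using univ s t unfolding universal_for_finite_hyperbolic_def by blast
  obtain h where h: "isometry (submetric m (f ` ?A)) (submetric m (g ` ?A)) h"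
    and hf: "\<forall>x\<in>?A. h (f x) = g x"
    using isometry_between_images[OF f g, of ?A] eq by auto
  have "f ` ?A \<subseteq> mspace m" "g ` ?A \<subseteq> mspace m"
    using f g unfolding isometric_embedding_def by auto
  moreover have "finite (f ` ?A)" "finite (g ` ?A)"
    using s(1) by auto
  ultimately obtain k where k: "isometry m m k" and kh: "\<forall>x\<in>f ` ?A. k x = h x"
    using h homog[unfolded homogeneous_for_finite_def, rule_format, of "f ` ?A" "g ` ?A" h]
    by blast
  have "isometric_embedding s m (k \<circ> f)"
    using f k unfolding isometry_def isometric_embedding_def by (auto simp: Pi_iff)
  moreover have "\<forall>x\<in>?A. (k \<circ> f) x = g x"
    using kh hf by auto
  ultimately show ?thesis
    using g by blast
qed

text \<open>Reduces a concrete space to integer inequalities that can be checked by evaluation. In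
  units of \<delta> / 2 the slack 2\<delta> becomes 4.\<close>

lemma scaled_hyperbolic_metric:
  fixes D :: "'b \<Rightarrow> 'b \<Rightarrow> int" and N :: "'b set"
  assumes "\<delta> > 0"
    and zero: "\<forall>x\<in>N. \<forall>y\<in>N. 0 \<le> D x y \<and> D x y = D y x \<and> (D x y = 0 \<longleftrightarrow> x = y)"
    and triangle: "\<forall>x\<in>N. \<forall>y\<in>N. \<forall>z\<in>N. D x z \<le> D x y + D y z"
    and four: "\<forall>x\<in>N. \<forall>y\<in>N. \<forall>z\<in>N. \<forall>w\<in>N.
      D x w + D y z \<le> max (D x y + D z w) (D x z + D y w) + 4"
  obtains s where "mspace s = N" "hyperbolic \<delta> s"
    "\<And>x y. x \<in> N \<Longrightarrow> y \<in> N \<Longrightarrow> mdist s x y = \<delta> / 2 * of_int (D x y)"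
proof -
  \<comment> \<open>\<open>Metric_space\<close> demands nonnegativity and symmetry for all
    arguments, also outside \<open>N\<close>; the value 0 there supplies both.\<close>
  define d where "d x y = \<delta> / 2 * of_int (if x \<in> N \<and> y \<in> N then D x y else 0)" for x y
  interpret Metric_space N d
  proof
    show "0 \<le> d x y" for x y
      using zero \<open>\<delta> > 0\<close> by (auto simp: d_def)
    show "d x y = d y x" for x y
      using zero by (auto simp: d_def)
    show "d x y = 0 \<longleftrightarrow> x = y" if "x \<in> N" "y \<in> N" for x y
      using zero that \<open>\<delta> > 0\<close> by (auto simp: d_def)
    show "d x z \<le> d x y + d y z" if "x \<in> N" "y \<in> N" "z \<in> N" for x y z
    proof -
      have "real_of_int (D x z) \<le> of_int (D x y + D y z)"
        using triangle that by (simp only: of_int_le_iff)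
      then have "\<delta> / 2 * real_of_int (D x z) \<le> \<delta> / 2 * of_int (D x y + D y z)"
        using \<open>\<delta> > 0\<close> by (intro mult_left_mono) auto
      then show ?thesis
        using that by (simp add: d_def distrib_left)
    qed
  qed
  define s where "s = metric (N, d)"
  have s: "mspace s = N" "mdist s = d"
    by (simp_all add: s_def)
  have "d x w + d y z \<le> max (d x y + d z w) (d x z + d y w) + 2 * \<delta>"
    if "x \<in> N" "y \<in> N" "z \<in> N" "w \<in> N" for x y z w
  proof -
    have *: "D x w + D y z \<le> D x y + D z w + 4 \<or> D x w + D y z \<le> D x z + D y w + 4"
      using four that by (auto simp: max_def split: if_splits)
    have scale: "\<delta> / 2 * real_of_int p + \<delta> / 2 * of_int q \<le> \<delta> / 2 * of_int u + \<delta> / 2 * of_int v + 2 * \<delta>"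
      if "p + q \<le> u + v + 4" for p q u v
    proof -
      have "real_of_int (p + q) \<le> of_int (u + v + 4)"
        using that by (simp only: of_int_le_iff)
      then have "\<delta> / 2 * real_of_int (p + q) \<le> \<delta> / 2 * of_int (u + v + 4)"
        using \<open>\<delta> > 0\<close> by (intro mult_left_mono) auto
      then show ?thesis
        by (simp add: distrib_left)
    qed
    from * show ?thesis
      using that by (auto simp: d_def dest!: scale)
  qed
  then have "hyperbolic \<delta> s"
    by (simp add: hyperbolic_def s)
  with s show ?thesis
    by (intro that[of s]) (simp_all add: d_def)
qed

text \<open>The points \<open>a, b, c, e, x, y\<close> are numbered 0 to 5; distances are in units of \<open>\<delta> / 2\<close>.
  The entry 0 for the undetermined distance between \<open>x\<close> and \<open>y\<close> is a dummy.\<close>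

definition dist_table :: "nat \<Rightarrow> nat \<Rightarrow> int" where
  "dist_table i j =
    [[ 0, 28, 25, 28, 20, 16],
     [28,  0, 25, 28, 20, 16],
     [25, 25,  0, 20, 20, 14],
     [28, 28, 20,  0, 20, 20],
     [20, 20, 20, 20,  0,  0],
     [16, 16, 14, 20,  0,  0]] ! i ! j"

text \<open>Each set omits 4 or 5, so only genuine distances enter and finitely many numeral facts
  remain.\<close>

lemma dist_table_metric:
  assumes "N = {0, 1, 2, 3, 4} \<or> N = {0, 1, 2, 3, 5}"
  shows "\<forall>x\<in>N. \<forall>y\<in>N. 0 \<le> dist_table x y \<and> dist_table x y = dist_table y x \<and>
      (dist_table x y = 0 \<longleftrightarrow> x = y)"
    and "\<forall>x\<in>N. \<forall>y\<in>N. \<forall>z\<in>N. dist_table x z \<le> dist_table x y + dist_table y z"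
  using assms
  by (elim disjE; hypsubst; simp only: ball_simps; simp add: dist_table_def)+

lemma dist_table_four_point:
  assumes "N = {0, 1, 2, 3, 4} \<or> N = {0, 1, 2, 3, 5}"
  shows "\<forall>x\<in>N. \<forall>y\<in>N. \<forall>z\<in>N. \<forall>w\<in>N. dist_table x w + dist_table y z
      \<le> max (dist_table x y + dist_table z w) (dist_table x z + dist_table y w) + 4"
  using assms
  by (elim disjE; hypsubst; simp only: ball_simps; intro conjI TrueI; simp add: dist_table_def)

theorem theorem1p3:
  fixes \<delta> :: real
  assumes "\<delta> > 0"
  shows "\<not> (\<exists>M :: 'a metric. hyperbolic \<delta> M \<and>
           universal_for_finite_hyperbolic \<delta> M \<and> homogeneous_for_finite M)"
proof
  assume "\<exists>M :: 'a metric. hyperbolic \<delta> M \<and>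
    universal_for_finite_hyperbolic \<delta> M \<and> homogeneous_for_finite M"
  then obtain M :: "'a metric" where hyp: "hyperbolic \<delta> M"
    and univ: "universal_for_finite_hyperbolic \<delta> M" and homog: "homogeneous_for_finite M"
    by blast
  let ?X = "{0, 1, 2, 3, 4::nat}" and ?Y = "{0, 1, 2, 3, 5::nat}"
  obtain s where s: "mspace s = ?X" "hyperbolic \<delta> s"
    and ds: "\<And>i j. i \<in> ?X \<Longrightarrow> j \<in> ?X \<Longrightarrow> mdist s i j = \<delta> / 2 * of_int (dist_table i j)"
    by (rule scaled_hyperbolic_metric[OF assms dist_table_metric dist_table_four_point, of ?X])
      simp_all
  obtain t where t: "mspace t = ?Y" "hyperbolic \<delta> t"
    and dt: "\<And>i j. i \<in> ?Y \<Longrightarrow> j \<in> ?Y \<Longrightarrow> mdist t i j = \<delta> / 2 * of_int (dist_table i j)"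
    by (rule scaled_hyperbolic_metric[OF assms dist_table_metric dist_table_four_point, of ?Y])
      simp_all
  obtain f g where f: "isometric_embedding s M f" and g: "isometric_embedding t M g"
    and fg: "\<And>i. i \<in> mspace s \<inter> mspace t \<Longrightarrow> f i = g i"
  proof -
    \<comment> \<open>Both metrics read the same table entries on the common points 0 to 3.\<close>
    have "mdist s i j = mdist t i j"
      if "i \<in> mspace s \<inter> mspace t" "j \<in> mspace s \<inter> mspace t" for i j
      using that by (metis IntD1 IntD2 ds dt s(1) t(1))
    moreover have "finite (mspace s)" "finite (mspace t)"
      by (simp_all add: s t)
    ultimately show ?thesis
      using amalgamation[OF univ homog _ s(2) _ t(2)] that by blast
  qed
  have in_M: "g i \<in> mspace M" if "i \<in> ?Y" for i
    using g that unfolding isometric_embedding_def t(1) by blast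
  have x_M: "f 4 \<in> mspace M"
    using f unfolding isometric_embedding_def s(1) by blast
  have dg: "mdist M (g i) (g j) = \<delta> / 2 * of_int (dist_table i j)" if "i \<in> ?Y" "j \<in> ?Y" for i j
    using g that dt[OF that] unfolding isometric_embedding_def t(1) by metis
  have df: "mdist M (f 4) (g i) = \<delta> / 2 * of_int (dist_table 4 i)" if "i \<in> {0, 1, 2, 3}" for i
  proof -
    have "mdist M (f 4) (f i) = \<delta> / 2 * of_int (dist_table 4 i)"
      using f that ds[of 4 i] unfolding isometric_embedding_def s(1) by auto
    then show ?thesis
      using fg[of i] that by (auto simp: s(1) t(1))
  qed
  let ?d = "mdist M"
  have four: "?d p w + ?d q r \<le> max (?d p q + ?d r w) (?d p r + ?d q w) + 2 * \<delta>"
    if "p \<in> mspace M" "q \<in> mspace M" "r \<in> mspace M" "w \<in> mspace M" for p q r w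
    using hyp that unfolding hyperbolic_def Let_def by blast
  have "?d (f 4) (g 5) + ?d (g 0) (g 1)
      \<le> max (?d (f 4) (g 0) + ?d (g 1) (g 5)) (?d (f 4) (g 1) + ?d (g 0) (g 5)) + 2 * \<delta>"
    by (intro four x_M in_M) auto
  \<comment> \<open>In units of \<delta> / 2: d(x,y) + 28 is at most (20 + 16) + 4, hence d(x,y) is
    at most 12.\<close>
  then have upper: "?d (f 4) (g 5) \<le> 6 * \<delta>"
    by (simp add: dg df dist_table_def)
  have "?d (f 4) (g 2) + ?d (g 5) (g 3)
      \<le> max (?d (f 4) (g 5) + ?d (g 3) (g 2)) (?d (f 4) (g 3) + ?d (g 5) (g 2)) + 2 * \<delta>"
    by (intro four x_M in_M) auto
  \<comment> \<open>In the same units the left side is 40. The second pairing yields only 20 + 14 +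
    4 = 38, so the first must dominate: 40 is at most d(x,y) + 20 + 4, and d(x,y) is at least
    16.\<close>
  then have "?d (f 4) (g 5) \<ge> 8 * \<delta>"
    using assms by (simp add: dg df dist_table_def max_def split: if_splits)
  with upper assms show False
    by simp
qed

end
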